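(* Let $(G_m)_{m\in\mathbb{Z}}$ be a generalized Fibonacci sequence, let $a,b$ be integers, let $\phi=\frac12(1+\sqrt5)$, let $x$ be a complex number with $|x|<\phi^{-|b|}$, and put $\Delta = 1-L_b x+(-1)^b x^2$. Then the following infinite series identities hold: $$\begin{aligned} \sum_{k=0}^{\infty} x^k G_{a+bk} &= \frac{1}{\Delta} P(1,0),\\ \sum_{k=0}^{\infty} x^k k\, G_{a+bk} &= \frac{1}{\Delta^2} x P(2,1),\\ \sum_{k=0}^{\infty} x^k k^2 G_{a+bk} &= \frac{1}{\Delta^2} x P(2,1) + \frac{2}{\Delta^3} x^2 P(3,2),\\ \sum_{k=0}^{\infty} x^k k^3 G_{a+bk} &= \frac{1}{\Delta^2} x P(2,1) + \frac{6}{\Delta^3} x^2 P(3,2) + \frac{6}{\Delta^4} x^3 P(4,3),\\ \sum_{k=0}^{\infty} x^k k^4 G_{a+bk} &= \frac{1}{\Delta^2} x P(2,1) + \frac{14}{\Delta^3} x^2 P(3,2) + \frac{36}{\Delta^4} x^3 P(4,3) + \frac{24}{\Delta^5} x^4 P(5,4),\\ \sum_{k=0}^{\infty} x^k k^5 G_{a+bk} &= \frac{1}{\Delta^2} x P(2,1) + \frac{30}{\Delta^3} x^2 P(3,2) + \frac{150}{\Delta^4} x^3 P(4,3) + \frac{240}{\Delta^5} x^4 P(5,4) + \frac{120}{\Delta^6} x^5 P(6,5). \end{aligned}$$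
   Context: A generalized Fibonacci sequence is a sequence $(G_m)_{m\in\mathbb{Z}}$ of complex numbers with $G_{m+2}=G_{m+1}+G_m$ for all integers $m$ (with arbitrary seed $G_0,G_1$). $L_m$ is the Lucas number: $L_0=2$, $L_1=1$, $L_{m+2}=L_{m+1}+L_m$ for all integers $m$ (including negative indices). For given $a,b,x$ and $G$, and for integers $v,w\ge 0$, $P(v,w) = \sum_{k=0}^v \binom{v}{k} (-1)^{(b+1)k} x^k G_{a+bw-bk}$. Convention: $x^0=1$, also for $x=0$. *)

theory Defs
  imports "HOL-Analysis.Analysis"
begin

definition gen_fib :: "(int \<Rightarrow> complex) \<Rightarrow> bool" where
  "gen_fib G \<longleftrightarrow> (\<forall>m. G (m + 2) = G (m + 1) + G m)"

(* Lucas numbers on all integers: for negative m the recurrence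
   L (m + 2) = L (m + 1) + L m is solved for L m. The recurrence itself,
   for every integer m, is lucas_rec below. *)
function lucas :: "int \<Rightarrow> int" where
  "lucas m = (if m = 0 then 2
              else if m = 1 then 1
              else if m > 1 then lucas (m - 1) + lucas (m - 2)
              else lucas (m + 2) - lucas (m + 1))"
  by pat_completeness auto
termination
  by (relation "Wellfounded.measure (\<lambda>m. nat \<bar>2 * m - 1\<bar>)") auto

declare lucas.simps [simp del]

lemma lucas_0: "lucas 0 = 2"
  by (subst lucas.simps) simp

lemma lucas_1: "lucas 1 = 1"
  by (subst lucas.simps) simp

lemma lucas_rec: "lucas (m + 2) = lucas (m + 1) + lucas m"
proof (cases "m \<ge> 0")
  case True
  then have "m + 2 - 1 = m + 1" "m + 2 - 2 = m"
    by simp_all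
  with True show ?thesis
    by (subst lucas.simps) (simp add: add.commute)
next
  case False
  then have "lucas m = lucas (m + 2) - lucas (m + 1)"
    by (subst (1) lucas.simps) simp
  then show ?thesis
    by simp
qed

(* The exponents (b + 1) k may be negative, hence the integer power powi. *)
definition fib_P :: "(int \<Rightarrow> complex) \<Rightarrow> int \<Rightarrow> int \<Rightarrow> complex \<Rightarrow> nat \<Rightarrow> nat \<Rightarrow> complex" where
  "fib_P G a b x v w =
     (\<Sum>k = 0..v. of_nat (v choose k) * (-1) powi ((b + 1) * int k) * x ^ k
                   * G (a + b * int w - b * int k))"

end

(* By Binet's formula, G is a linear combination of the two sequences m \<mapsto> p powi m with
   p + q = 1 and p * q = -1. For such a sequence the k-th term is a geometric sequence in
   z = x * p powi b. Expanding k ^ n in the binomials (k choose j), with coefficients j! S(n, j),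
   and using \<Sum>k. (k choose j) z^k = z^j / (1 - z)^(j + 1), one is left with a sum of fractions;
   extending the j-th one by (1 - x * q powi b)^(j + 1) turns its denominator into
   \<Delta>^(j + 1) and, by the binomial theorem, its numerator into x^j P(j + 1, j). *)
theory Submission
  imports Defs "HOL-Combinatorics.Stirling"
begin

text \<open>Multiplying by \<open>k\<close> sends \<open>k choose j\<close> to a combination of
  itself and \<open>k choose Suc j\<close>. The two weights, \<open>j\<close> and
  \<open>Suc j\<close>, match the recurrence of the Stirling numbers of the second kind.\<close>

lemma power_eq_sum_Stirling_binomial:
  "k ^ n = (\<Sum>j\<le>n. Stirling n j * fact j * (k choose j))"
proof (induction n)
  case 0
  then show ?case by simp
next
  case (Suc n)
  \<comment> \<open>Split \<open>k = j + (k - j)\<close> and absorb \<open>k - j\<close>.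
    Subtraction on naturals truncates, so \<open>j > k\<close> is separate: both binomials are zero
    there.\<close>
  have absorb: "k * (k choose j) = j * (k choose j) + Suc j * (k choose Suc j)" for j
  proof (cases "j \<le> k")
    case True
    have "Suc j * (k choose Suc j) = (k - j) * (k choose j)"
      using binomial_absorb_comp[of k j] binomial_absorption[of j k] by simp
    then show ?thesis
      using True by (simp flip: add_mult_distrib)
  qed (simp add: binomial_eq_0)
  have "k ^ Suc n = (\<Sum>j\<le>n. Stirling n j * fact j * (k * (k choose j)))"
    by (simp add: Suc.IH sum_distrib_left mult_ac)
  also have "\<dots> = (\<Sum>j\<le>n. j * Stirling n j * fact j * (k choose j))
      + (\<Sum>j\<le>n. Stirling n j * fact (Suc j) * (k choose Suc j))"
    by (simp only: absorb flip: sum.distrib) (simp add: algebra_simps)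
  \<comment> \<open>The added top term is zero because \<open>Stirling n (Suc n) = 0\<close>. The
    longer range lets the index shift come out at \<open>j\<le>n\<close>; the shift loses only
    \<open>j = 0\<close>, killed by the factor \<open>j\<close>.\<close>
  also have "(\<Sum>j\<le>n. j * Stirling n j * fact j * (k choose j))
      = (\<Sum>j\<le>Suc n. j * Stirling n j * fact j * (k choose j))"
    by simp
  also have "\<dots> = (\<Sum>j\<le>n. Suc j * Stirling n (Suc j) * fact (Suc j) * (k choose Suc j))"
    by (subst sum.atMost_Suc_shift) simp
  also have "\<dots> + (\<Sum>j\<le>n. Stirling n j * fact (Suc j) * (k choose Suc j))
      = (\<Sum>j\<le>n. Stirling (Suc n) (Suc j) * fact (Suc j) * (k choose Suc j))"
    by (simp only: Stirling.simps distrib_right sum.distrib)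
  also have "\<dots> = (\<Sum>j\<le>Suc n. Stirling (Suc n) j * fact j * (k choose j))"
    by (subst sum.atMost_Suc_shift) simp
  finally show ?case .
qed

text \<open>This is the binomial series of \<open>(1 - z)\<close> to the power
  \<open>-(j + 1)\<close>, multiplied by \<open>z ^ j\<close>.\<close>

lemma sums_binomial_column:
  fixes z :: complex
  assumes "norm z < 1"
  shows "(\<lambda>k. of_nat (k choose j) * z ^ k) sums (z ^ j / (1 - z) ^ (j + 1))"
proof -
  have z: "1 - z \<noteq> 0"
    using assms by auto
  have coeff: "(- of_nat (j + 1) gchoose n) * (- z) ^ n = of_nat (n + j choose j) * z ^ n" for n
  proof -
    have "((- of_nat (j + 1) :: complex) gchoose n) = (- 1) ^ n * (of_nat (n + j) gchoose n)"
      by (subst gbinomial_minus) (simp add: algebra_simps)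
    also have "(of_nat (n + j) gchoose n :: complex) = of_nat (n + j choose j)"
      using binomial_symmetric[of n "n + j"] by (simp only: flip: binomial_gbinomial) simp
    finally have "(- of_nat (j + 1) gchoose n) * (- z) ^ n
        = of_nat (n + j choose j) * ((- 1) ^ n * (- z) ^ n)"
      by (simp only: mult_ac)
    also have "(- 1) ^ n * (- z) ^ n = z ^ n"
      by (simp flip: power_mult_distrib)
    finally show ?thesis .
  qed
  have "(\<lambda>n. (- of_nat (j + 1) gchoose n) * (- z) ^ n) sums (1 + (- z)) powr (- of_nat (j + 1))"
    using assms by (intro gen_binomial_complex) simp
  also have "(1 + (- z)) powr (- of_nat (j + 1)) = 1 / (1 - z) ^ (j + 1)"
    using z powr_nat'[of "1 - z" "j + 1"]
    by (simp only: powr_minus add_uminus_conv_diff) (simp add: divide_simps)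
  finally have "(\<lambda>n. of_nat (n + j choose j) * z ^ n) sums (1 / (1 - z) ^ (j + 1))"
    by (simp only: coeff)
  from sums_mult[OF this, of "z ^ j"]
  have "(\<lambda>n. of_nat (n + j choose j) * z ^ (n + j)) sums (z ^ j / (1 - z) ^ (j + 1))"
    by (simp add: power_add mult_ac)
  \<comment> \<open>The first \<open>j\<close> terms vanish, since \<open>k choose j = 0\<close> for
    \<open>k < j\<close>, so shifting the index keeps the sum.\<close>
  then show ?thesis
    by (subst (asm) sums_zero_iff_shift) simp_all
qed

lemma sums_power_times_geometric:
  fixes z :: complex
  assumes "norm z < 1"
  shows "(\<lambda>k. of_nat k ^ n * z ^ k) sums
    (\<Sum>j\<le>n. of_nat (Stirling n j * fact j) * (z ^ j / (1 - z) ^ (j + 1)))"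
proof -
  have "of_nat k ^ n * z ^ k
      = (\<Sum>j\<le>n. of_nat (Stirling n j * fact j) * (of_nat (k choose j) * z ^ k))" for k
    by (simp only: power_eq_sum_Stirling_binomial[of k n] sum_distrib_right of_nat_sum
          of_nat_mult mult.assoc flip: of_nat_power)
  then show ?thesis
    using assms by (simp only:) (intro sums_sum sums_mult sums_binomial_column)
qed

lemma gen_fib_unique:
  assumes "gen_fib F" "gen_fib G" "F 0 = G 0" "F 1 = G 1"
  shows "F = G"
proof
  fix m
  have F: "F (i + 2) = F (i + 1) + F i" and G: "G (i + 2) = G (i + 1) + G i" for i
    using assms(1,2) by (simp_all add: gen_fib_def)
  have "F m = G m \<and> F (m + 1) = G (m + 1)"
  proof (induction m rule: int_induct[where k = 0])
    case base
    then show ?case using assms by simp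
  next
    case (step1 i)
    then show ?case using F[of i] G[of i] by (simp add: add.assoc)
  next
    case (step2 i)
    then show ?case using F[of "i - 1"] G[of "i - 1"] by (simp add: add.commute)
  qed
  then show "F m = G m" ..
qed

text \<open>By Vieta the hypotheses say that \<open>p\<close> and \<open>q\<close> are the roots of
  \<open>r ^ 2 = r + 1\<close>. Multiplying this equation by \<open>r powi m\<close> gives the
  recurrence.\<close>

lemma gen_fib_powi:
  assumes "p + q = 1" "p * q = - 1"
  shows "gen_fib (\<lambda>m. A * p powi m + B * q powi m)"
proof -
  have rec: "r powi (m + 2) = r powi (m + 1) + r powi m" if "r * (r - 1) = 1" for r :: complex and m
  proof -
    have [simp]: "r \<noteq> 0" using that by auto
    have "r ^ 2 = r + 1" using that by (simp add: power2_eq_square algebra_simps)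
    then show ?thesis
      by (simp add: power_int_add distrib_left)
  qed
  have "p * (p - 1) = 1" "q * (q - 1) = 1"
    using assms by algebra+
  then show ?thesis
    by (simp add: gen_fib_def rec algebra_simps)
qed

text \<open>The coefficients solve \<open>A + B = G 0\<close> and
  \<open>A * p + B * q = G 1\<close>, a system with determinant \<open>q - p\<close>.\<close>

lemma Binet_exists:
  assumes "gen_fib G" "p + q = 1" "p * q = - 1" "p \<noteq> q"
  shows "\<exists>A B. G = (\<lambda>m. A * p powi m + B * q powi m)"
proof -
  define B where "B = (G 1 - G 0 * p) / (q - p)"
  have B: "B * (q - p) = G 1 - G 0 * p"
    using assms(4) by (simp add: B_def)
  have "G = (\<lambda>m. (G 0 - B) * p powi m + B * q powi m)"
    by (rule gen_fib_unique[OF assms(1) gen_fib_powi[OF assms(2,3)]])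
       (use B in \<open>simp_all add: algebra_simps\<close>)
  then show ?thesis by blast
qed

lemma lucas_eq_powi:
  assumes "p + q = 1" "p * q = - 1"
  shows "of_int (lucas b) = (p powi b + q powi b :: complex)"
proof -
  have "(\<lambda>m. of_int (lucas m)) = (\<lambda>m. 1 * p powi m + 1 * q powi m)"
    by (rule gen_fib_unique[OF _ gen_fib_powi[OF assms]])
       (use assms in \<open>simp_all add: gen_fib_def lucas_rec lucas_0 lucas_1\<close>)
  then show ?thesis by (simp add: fun_eq_iff)
qed

lemma fib_P_linear:
  "fib_P (\<lambda>m. A * F m + B * G m) a b x v w = A * fib_P F a b x v w + B * fib_P G a b x v w"
  by (simp add: fib_P_def sum_distrib_left sum.distrib algebra_simps)

text \<open>Since \<open>p * q = - 1\<close>, the sign \<open>(- 1) powi b\<close> turns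
  \<open>p powi (- b)\<close> into \<open>q powi b\<close>. The sum then becomes the binomial
  expansion of a power of \<open>1 - x * q powi b\<close>.\<close>

lemma fib_P_powi:
  assumes "p * q = - 1"
  shows "fib_P (\<lambda>m. p powi m) a b x v w = p powi (a + b * int w) * (1 - x * q powi b) ^ v"
proof -
  have p: "p \<noteq> 0" using assms by auto
  have "(- 1) powi b = p powi b * q powi b"
    by (simp add: assms flip: power_int_mult_distrib)
  then have q: "q powi b = (- 1) powi b * p powi (- b)"
    using p by (simp add: power_int_minus field_simps)
  have summand: "of_nat (v choose k) * (- 1) powi ((b + 1) * int k) * x ^ k
        * p powi (a + b * int w - b * int k)
      = p powi (a + b * int w) * (of_nat (v choose k) * (- (x * q powi b)) ^ k * 1 ^ (v - k))" for k
  proof -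
    \<comment> \<open>The \<open>b\<close> in \<open>b + 1\<close> supplies the sign that produces
      \<open>q powi b\<close>; the \<open>1\<close> supplies the minus in front of
      \<open>x\<close>.\<close>
    have "(- 1) powi ((b + 1) * int k) = ((- 1) powi b * (- 1 :: complex)) ^ k"
      by (simp add: power_int_mult power_int_add)
    moreover have "p powi (a + b * int w - b * int k) = p powi (a + b * int w) * (p powi (- b)) ^ k"
      using p by (simp add: power_int_diff power_int_mult power_int_minus power_inverse divide_inverse)
    ultimately show ?thesis
      by (simp add: q mult_ac flip: power_mult_distrib)
  qed
  have "fib_P (\<lambda>m. p powi m) a b x v w
      = p powi (a + b * int w) * (\<Sum>k\<le>v. of_nat (v choose k) * (- (x * q powi b)) ^ k * 1 ^ (v - k))"
    by (simp only: fib_P_def summand sum_distrib_left atLeast0AtMost)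
  also have "(\<Sum>k\<le>v. of_nat (v choose k) * (- (x * q powi b)) ^ k * 1 ^ (v - k))
      = (- (x * q powi b) + 1) ^ v"
    by (rule binomial_ring[symmetric])
  finally show ?thesis by simp
qed

text \<open>The bound on \<open>x * p powi b\<close> gives convergence, the one on
  \<open>x * q powi b\<close> allows the fractions to be extended. The hypotheses are symmetric in
  \<open>p\<close> and \<open>q\<close>, so the lemma serves both Binet terms.\<close>

lemma sums_power_times_powi:
  fixes p q x :: complex
  assumes pq: "p + q = 1" "p * q = - 1"
    and conv: "norm (x * p powi b) < 1" "norm (x * q powi b) < 1"
    and \<Delta>: "\<Delta> = 1 - of_int (lucas b) * x + (- 1) powi b * x ^ 2"
  shows "(\<lambda>k. x ^ k * of_nat k ^ n * p powi (a + b * int k)) sums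
    (\<Sum>j\<le>n. of_nat (Stirling n j * fact j) / \<Delta> ^ (j + 1) * x ^ j
        * fib_P (\<lambda>m. p powi m) a b x (j + 1) j)"
proof -
  have p: "p \<noteq> 0" using pq(2) by auto
  have "(- 1) powi b = p powi b * q powi b"
    by (simp add: pq(2) flip: power_int_mult_distrib)
  then have factor: "\<Delta> = (1 - x * p powi b) * (1 - x * q powi b)"
    by (simp add: \<Delta> lucas_eq_powi[OF pq] power2_eq_square algebra_simps)
  have nz: "1 - x * q powi b \<noteq> 0"
    using conv(2) by auto
  \<comment> \<open>Extend by \<open>(1 - x * q powi b) ^ (j + 1)\<close>. The factor
    \<open>p powi (a + b * int j)\<close> that remains is what fixes \<open>w = j\<close>, and the
    exponent fixes \<open>v = j + 1\<close>.\<close>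
  have "p powi a * ((x * p powi b) ^ j / (1 - x * p powi b) ^ (j + 1))
      = 1 / \<Delta> ^ (j + 1) * x ^ j * fib_P (\<lambda>m. p powi m) a b x (j + 1) j" for j
    using p nz
    by (simp add: fib_P_powi[OF pq(2)] factor power_mult_distrib power_int_add power_int_mult
          del: power_Suc)
  then have coeff: "p powi a * (of_nat (Stirling n j * fact j)
        * ((x * p powi b) ^ j / (1 - x * p powi b) ^ (j + 1)))
      = of_nat (Stirling n j * fact j) / \<Delta> ^ (j + 1) * x ^ j
        * fib_P (\<lambda>m. p powi m) a b x (j + 1) j" for j
    unfolding mult.left_commute[of "p powi a"] by (simp only: divide_inverse mult_1_left mult.assoc)
  have "p powi a * (of_nat k ^ n * (x * p powi b) ^ k)
      = x ^ k * of_nat k ^ n * p powi (a + b * int k)" for k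
    using p by (simp add: power_int_add power_int_mult power_mult_distrib)
  then show ?thesis
    using sums_mult[OF sums_power_times_geometric[OF conv(1), of n], of "p powi a"]
    by (simp only: sum_distrib_left coeff)
qed

lemma sums_power_times_gen_fib:
  fixes x :: complex
  assumes G: "gen_fib G"
    and x: "norm x < ((1 + sqrt 5) / 2) powi (- \<bar>b\<bar>)"
    and \<Delta>: "\<Delta> = 1 - of_int (lucas b) * x + (- 1) powi b * x ^ 2"
  shows "(\<lambda>k. x ^ k * of_nat k ^ n * G (a + b * int k)) sums
    (\<Sum>j\<le>n. of_nat (Stirling n j * fact j) / \<Delta> ^ (j + 1) * x ^ j * fib_P G a b x (j + 1) j)"
proof -
  define \<phi> :: real where "\<phi> = (1 + sqrt 5) / 2"
  define p q :: complex where "p = of_real \<phi>" and "q = of_real (1 - \<phi>)"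
  have "\<phi> \<ge> 1"
    by (simp add: \<phi>_def)
  have \<phi>: "\<phi> * (1 - \<phi>) = - 1"
    by (simp add: \<phi>_def field_simps)
  have pq: "p + q = 1" "p * q = - 1"
    by (simp_all only: p_def q_def \<phi> flip: of_real_mult of_real_add) simp_all
  have "p \<noteq> q"
    using \<open>\<phi> \<ge> 1\<close> by (simp add: p_def q_def del: of_real_diff)
  have norm_q: "norm q = inverse \<phi>"
  proof -
    have "1 - \<phi> = - inverse \<phi>"
      using \<phi> \<open>\<phi> \<ge> 1\<close> by (simp add: field_simps)
    then show ?thesis
      using \<open>\<phi> \<ge> 1\<close> by (simp add: q_def norm_inverse del: of_real_diff)
  qed
  \<comment> \<open>Needed for \<open>c = b\<close> and, because
    \<open>norm q = inverse \<phi>\<close>, for \<open>c = - b\<close>. Both are at most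
    \<open>\<bar>b\<bar>\<close>, which explains the absolute value in the radius.\<close>
  have bound: "norm x * \<phi> powi c < 1" if "c \<le> \<bar>b\<bar>" for c
  proof -
    have "norm x * \<phi> powi c \<le> norm x * \<phi> powi \<bar>b\<bar>"
      using that \<open>\<phi> \<ge> 1\<close> by (intro mult_left_mono power_int_increasing) auto
    also have "\<dots> < \<phi> powi (- \<bar>b\<bar>) * \<phi> powi \<bar>b\<bar>"
      using x \<open>\<phi> \<ge> 1\<close> unfolding \<phi>_def[symmetric]
      by (intro mult_strict_right_mono zero_less_power_int) auto
    also have "\<dots> = 1"
      using \<open>\<phi> \<ge> 1\<close> by (simp add: power_int_minus)
    finally show ?thesis .
  qed
  have conv: "norm (x * p powi b) < 1" "norm (x * q powi b) < 1"
    using bound[of b] bound[of "- b"] \<open>\<phi> \<ge> 1\<close>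
    by (simp_all add: norm_mult norm_power_int norm_q p_def power_int_minus power_int_inverse)
  obtain A B where AB: "G = (\<lambda>m. A * p powi m + B * q powi m)"
    using Binet_exists[OF G pq \<open>p \<noteq> q\<close>] by blast
  have qp: "q + p = 1" "q * p = - 1"
    using pq by (simp_all add: add.commute mult.commute)
  show ?thesis
    unfolding AB fib_P_linear
    using sums_add[OF sums_mult[OF sums_power_times_powi[OF pq conv \<Delta>, of n a], of A]
        sums_mult[OF sums_power_times_powi[OF qp conv(2,1) \<Delta>, of n a], of B]]
    by (simp add: sum_distrib_left distrib_left mult_ac flip: sum.distrib)
qed

theorem mainTheorem8:
  fixes G :: "int \<Rightarrow> complex" and a b :: int and x \<Delta> :: complex
    and \<phi> :: real and P :: "nat \<Rightarrow> nat \<Rightarrow> complex"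
  assumes "gen_fib G"
    and "\<phi> = (1 + sqrt 5) / 2"
    and "norm x < \<phi> powi (- \<bar>b\<bar>)"
    and "\<Delta> = 1 - of_int (lucas b) * x + (-1) powi b * x ^ 2"
    and "P = fib_P G a b x"
  shows "(\<lambda>k. x ^ k * G (a + b * int k)) sums (1 / \<Delta> * P 1 0)
    \<and> (\<lambda>k. x ^ k * of_nat k * G (a + b * int k)) sums
        (1 / \<Delta> ^ 2 * x * P 2 1)
    \<and> (\<lambda>k. x ^ k * of_nat k ^ 2 * G (a + b * int k)) sums
        (1 / \<Delta> ^ 2 * x * P 2 1 + 2 / \<Delta> ^ 3 * x ^ 2 * P 3 2)
    \<and> (\<lambda>k. x ^ k * of_nat k ^ 3 * G (a + b * int k)) sums
        (1 / \<Delta> ^ 2 * x * P 2 1 + 6 / \<Delta> ^ 3 * x ^ 2 * P 3 2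
         + 6 / \<Delta> ^ 4 * x ^ 3 * P 4 3)
    \<and> (\<lambda>k. x ^ k * of_nat k ^ 4 * G (a + b * int k)) sums
        (1 / \<Delta> ^ 2 * x * P 2 1 + 14 / \<Delta> ^ 3 * x ^ 2 * P 3 2
         + 36 / \<Delta> ^ 4 * x ^ 3 * P 4 3 + 24 / \<Delta> ^ 5 * x ^ 4 * P 5 4)
    \<and> (\<lambda>k. x ^ k * of_nat k ^ 5 * G (a + b * int k)) sums
        (1 / \<Delta> ^ 2 * x * P 2 1 + 30 / \<Delta> ^ 3 * x ^ 2 * P 3 2
         + 150 / \<Delta> ^ 4 * x ^ 3 * P 4 3 + 240 / \<Delta> ^ 5 * x ^ 4 * P 5 4
         + 120 / \<Delta> ^ 6 * x ^ 5 * P 6 5)"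
proof -
  note S = sums_power_times_gen_fib[OF assms(1) assms(3)[unfolded assms(2)] assms(4), where a = a,
      folded assms(5)]
  \<comment> \<open>These rules let the simplifier evaluate the coefficients
    \<open>Stirling n j * fact j\<close>, for instance 1, 30, 150, 240, 120 for
    \<open>n = 5\<close>. The \<open>j = 0\<close> term survives only for
    \<open>n = 0\<close>.\<close>
  have Stirling_numeral:
    "Stirling (numeral m) 0 = 0"
    "Stirling (numeral m) (Suc 0) = 1"
    "Stirling (numeral m) (numeral n)
      = numeral n * Stirling (pred_numeral m) (numeral n) + Stirling (pred_numeral m) (pred_numeral n)"
    for m n
    by (simp_all only: numeral_eq_Suc Stirling_1) simp_all
  show ?thesis
    using S[of 0] S[of 1] S[of 2] S[of 3] S[of 4] S[of 5]
    by (simp add: atMost_nat_numeral Stirling_numeral fact_numeral add_ac del: power_Suc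
          flip: numeral_2_eq_2)
qed

end
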